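(* Let $n\ge 2$, $1\le k\le n-1$ and $r\ge 1$ be integers. Let $\mathcal{T}_r$ be the set of orbits, under the action of $\mathbb{Z}_n$ by cyclic shifts, of the $k$-subsets $A\subseteq\mathbb{Z}_n$ whose block composition $c(A)$ has length $r$. Let $\mathcal{Z}_{n,k,r}=\mathcal{C}_{k,r}\times\mathcal{C}_{n-k,r}$ with the action of $\mathbb{Z}_r$ by simultaneous cyclic shifts, and let $\mathcal{Z}_{n,k,r}/\mathbb{Z}_r$ be its set of orbits. Then there is a bijection between $\mathcal{T}_r$ and $\mathcal{Z}_{n,k,r}/\mathbb{Z}_r$.
   Context: $\mathbb{Z}_n$ acts on subsets of $\mathbb{Z}_n$ by $(s,A)\mapsto A+s=\{a+s:a\in A\}$ modulo $n$; this preserves cardinality. For $A\subsetneq\mathbb{Z}_n$, the consecutive block structure $\pi(A)=(D_1,\ldots,D_\ell)$ is the partition of $A$ into its maximal subsets of consecutive elements modulo $n$, $D_i=\{d_i,d_i+1,\ldots,d_i+|D_i|-1\}$, ordered by $d_1<\cdots<d_\ell$ (as integers in $\{0,\ldots,n-1\}$), where $d_i$ is the first element of the block ($d_i-1\notin A$). The block composition of $A$ is $c(A)=(|D_1|,\ldots,|D_\ell|)$, of length $\ell$. $\mathcal{C}_{m,r}$ denotes the set of compositions of $m$ of length $r$, i.e. $r$-tuples of positive integers summing to $m$. $\mathbb{Z}_r$ acts on $\mathcal{C}_{m,r}$ by $s\cdot(c_1,\ldots,c_r)=(c_{s+1},\ldots,c_r,c_1,\ldots,c_s)$, and on $\mathcal{C}_{k,r}\times\mathcal{C}_{n-k,r}$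 by $s\cdot(c,c')=(s\cdot c,s\cdot c')$. *)

theory Defs
  imports "HOL-Algebra.Group_Action" "HOL-Algebra.Elementary_Groups"
begin

text \<open>
  \<open>\<int>\<^sub>n\<close> is \<^const>\<open>integer_mod_group\<close> \<open>n\<close>, with carrier \<open>{0..<n}\<close> for \<open>n > 0\<close>.
\<close>

definition shift_set :: "nat \<Rightarrow> int \<Rightarrow> int set \<Rightarrow> int set" where
  "shift_set n s A = (\<lambda>a. a \<otimes>\<^bsub>integer_mod_group n\<^esub> s) ` A"

definition cyclic_interval :: "nat \<Rightarrow> int \<Rightarrow> nat \<Rightarrow> int set" where
  "cyclic_interval n d m = (\<lambda>i. (d + int i) mod int n) ` {..<m}"

definition consecutive :: "nat \<Rightarrow> int set \<Rightarrow> bool" where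
  "consecutive n D \<longleftrightarrow>
     (\<exists>d\<in>carrier (integer_mod_group n). \<exists>m\<ge>1. D = cyclic_interval n d m)"

definition blocks :: "nat \<Rightarrow> int set \<Rightarrow> int set set" where
  "blocks n A =
     {D. D \<subseteq> A \<and> consecutive n D \<and>
         (\<forall>D'. D' \<subseteq> A \<and> consecutive n D' \<and> D \<subseteq> D' \<longrightarrow> D' = D)}"

text \<open>
  The first element is well defined for a block \<open>D\<close> of a proper subset \<open>A\<close> of \<open>\<int>\<^sub>n\<close>;
  it need not be the least integer in \<open>D\<close>, since a block may wrap around \<open>n\<close>.
\<close>

definition block_first :: "nat \<Rightarrow> int set \<Rightarrow> int set \<Rightarrow> int" where
  "block_first n A D = (THE d. d \<in> D \<and> (d - 1) mod int n \<notin> A)"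

definition block_structure :: "nat \<Rightarrow> int set \<Rightarrow> int set list" where
  "block_structure n A = sorted_key_list_of_set (block_first n A) (blocks n A)"

definition block_composition :: "nat \<Rightarrow> int set \<Rightarrow> nat list" where
  "block_composition n A = map card (block_structure n A)"

definition subsets_with_blocks :: "nat \<Rightarrow> nat \<Rightarrow> nat \<Rightarrow> int set set" where
  "subsets_with_blocks n k r =
     {A. A \<subseteq> carrier (integer_mod_group n) \<and> card A = k \<and> length (block_composition n A) = r}"

definition compositions :: "nat \<Rightarrow> nat \<Rightarrow> nat list set" where
  "compositions m r = {c. length c = r \<and> (\<forall>x\<in>set c. x \<ge> 1) \<and> sum_list c = m}"

definition rotate_pair :: "int \<Rightarrow> nat list \<times> nat list \<Rightarrow> nat list \<times> nat list" where
  "rotate_pair s = map_prod (rotate (nat s)) (rotate (nat s))"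

text \<open>
  The library's \<^const>\<open>group_action\<close> asks for maps that are extensional on the set acted upon,
  hence the restrictions below; they do not affect orbits.
\<close>

lemma group_action_shift_set:
  assumes "n > 0"
  shows "group_action (integer_mod_group n) (Pow (carrier (integer_mod_group n)))
           (\<lambda>s. restrict (shift_set n s) (Pow (carrier (integer_mod_group n))))"
proof -
  let ?G = "integer_mod_group n"
  let ?E = "Pow (carrier ?G)"
  let ?f = "\<lambda>s. restrict (shift_set n s) ?E"
  have closed: "shift_set n s A \<in> ?E" if "A \<in> ?E" for s A
    using assms that by (auto simp: shift_set_def carrier_integer_mod_group)
  have comp: "shift_set n s (shift_set n t A) = shift_set n ((s + t) mod int n) A" for s t A
    by (auto simp: shift_set_def image_image mod_simps algebra_simps)
  have zero: "shift_set n (0 :: int) A = A" if "A \<in> ?E" for A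
  proof -
    have "a mod int n = a" if "a \<in> A" for a
      using \<open>A \<in> ?E\<close> that assms by (auto simp: carrier_integer_mod_group subset_iff)
    then show ?thesis by (simp add: shift_set_def)
  qed
  have bij: "bij_betw (shift_set n s) ?E ?E" if "s \<in> carrier ?G" for s
  proof (rule bij_betw_byWitness[where f' = "shift_set n (- s)"])
    show "\<forall>A\<in>?E. shift_set n (- s) (shift_set n s A) = A"
      using zero by (simp add: comp)
    show "\<forall>A\<in>?E. shift_set n s (shift_set n (- s) A) = A"
      using zero by (simp add: comp)
  qed (use closed in blast)+
  have "?f \<in> hom ?G (BijGroup ?E)"
  proof (rule homI)
    show B: "?f s \<in> carrier (BijGroup ?E)" if "s \<in> carrier ?G" for s
      using bij[OF that] by (simp add: BijGroup_def Bij_def bij_betw_restrict_eq)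
    fix s t assume st: "s \<in> carrier ?G" "t \<in> carrier ?G"
    show "?f (s \<otimes>\<^bsub>?G\<^esub> t) = ?f s \<otimes>\<^bsub>BijGroup ?E\<^esub> ?f t"
      using B[OF st(1)] B[OF st(2)] closed
      by (auto simp: BijGroup_def compose_def comp fun_eq_iff restrict_def)
  qed
  then show ?thesis
    by (simp add: group_action_def group_hom_def group_hom_axioms_def group_BijGroup)
qed

lemma group_action_rotate_pair:
  assumes "r > 0"
  shows "group_action (integer_mod_group r) (compositions k r \<times> compositions m r)
           (\<lambda>s. restrict (rotate_pair s) (compositions k r \<times> compositions m r))"
proof -
  let ?G = "integer_mod_group r"
  let ?E = "compositions k r \<times> compositions m r"
  let ?f = "\<lambda>s. restrict (rotate_pair s) ?E"
  have sum: "sum_list (rotate i c) = sum_list c" for i and c :: "nat list"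
    by (metis add.commute append_take_drop_id rotate_drop_take sum_list_append)
  have closed: "rotate_pair s p \<in> ?E" if "p \<in> ?E" for s p
    using that by (auto simp: rotate_pair_def compositions_def sum)
  have rot: "rotate (nat s) (rotate (nat t) c) = rotate (nat ((s + t) mod int r)) c"
    if "length c = r" "s \<ge> 0" "t \<ge> 0" for s t and c :: "nat list"
  proof -
    have "nat ((s + t) mod int r) = (nat s + nat t) mod length c"
      using that by (simp add: nat_mod_distrib nat_add_distrib)
    then show ?thesis by (metis rotate_conv_mod rotate_rotate)
  qed
  have comp: "rotate_pair s (rotate_pair t p) = rotate_pair ((s + t) mod int r) p"
    if "p \<in> ?E" "s \<ge> 0" "t \<ge> 0" for s t p
    using that by (auto simp: rotate_pair_def compositions_def rot)
  have zero: "rotate_pair 0 p = p" for p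
    by (cases p) (simp add: rotate_pair_def)
  have bij: "bij_betw (rotate_pair s) ?E ?E" if "s \<in> carrier ?G" for s
  proof (rule bij_betw_byWitness[where f' = "rotate_pair (int r - s)"])
    have s: "s \<ge> 0" "int r - s \<ge> 0"
      using that assms by (auto simp: carrier_integer_mod_group)
    show "\<forall>p\<in>?E. rotate_pair (int r - s) (rotate_pair s p) = p"
      using comp[OF _ s(2) s(1)] zero by simp
    show "\<forall>p\<in>?E. rotate_pair s (rotate_pair (int r - s) p) = p"
      using comp[OF _ s(1) s(2)] zero by simp
  qed (use closed in blast)+
  have "?f \<in> hom ?G (BijGroup ?E)"
  proof (rule homI)
    show B: "?f s \<in> carrier (BijGroup ?E)" if "s \<in> carrier ?G" for s
      using bij[OF that] by (simp add: BijGroup_def Bij_def bij_betw_restrict_eq)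
    fix s t assume st: "s \<in> carrier ?G" "t \<in> carrier ?G"
    then have "s \<ge> 0" "t \<ge> 0"
      using assms by (auto simp: carrier_integer_mod_group)
    then show "?f (s \<otimes>\<^bsub>?G\<^esub> t) = ?f s \<otimes>\<^bsub>BijGroup ?E\<^esub> ?f t"
      using B[OF st(1)] B[OF st(2)] closed comp
      by (auto simp: BijGroup_def compose_def fun_eq_iff restrict_def)
  qed
  then show ?thesis
    by (simp add: group_action_def group_hom_def group_hom_axioms_def group_BijGroup)
qed

end

theory Submission
  imports Defs
begin

text \<open>
  A subset of \<open>\<int>\<^sub>n\<close> is a cyclic binary word of length \<open>n\<close>. Cut at the start of a block, the word
  begins with \<open>True\<close> and ends with \<open>False\<close>, so it factors uniquely into pieces
  \<open>True\<^sup>a False\<^sup>b\<close> with \<open>a, b > 0\<close>; the exponents form a pair of compositions. If two such words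
  are rotations \<open>u @ v\<close> and \<open>v @ u\<close> of each other, then \<open>u\<close> and \<open>v\<close> again begin with \<open>True\<close> and end
  with \<open>False\<close>, and uniqueness of the factorization shows that the pairs of compositions are
  rotations of each other.
\<close>

section \<open>Maps between sets of classes, and orbits\<close>

text \<open>Meant for orbit maps \<open>f\<close> and \<open>g\<close>. The first hypothesis makes
  the map induced by \<open>h\<close> on classes well defined and injective, the third makes it
  surjective; the bijection obtained is its inverse.\<close>

lemma ex_bij_betw_images:
  assumes "\<And>x y. x \<in> X \<Longrightarrow> y \<in> X \<Longrightarrow> f x = f y \<longleftrightarrow> g (h x) = g (h y)"
    and "\<And>x. x \<in> X \<Longrightarrow> h x \<in> Y"
    and "\<And>y. y \<in> Y \<Longrightarrow> \<exists>x\<in>X. g (h x) = g y"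
  shows "\<exists>p. bij_betw p (g ` Y) (f ` X)"
proof -
  \<comment> \<open>A class is sent through an arbitrary representative; \<open>q\<close> below
    records that the choice does not matter.\<close>
  define q where "q v = g (h (inv_into X f v))" for v
  have q: "q (f x) = g (h x)" if "x \<in> X" for x
    unfolding q_def using assms(1)[OF inv_into_into[of "f x" f X] that] that
    by (simp add: f_inv_into_f)
  have "bij_betw q (f ` X) (g ` Y)"
    unfolding bij_betw_def
  proof
    show "inj_on q (f ` X)"
      using q assms(1) by (auto simp: inj_on_def)
    have "q ` f ` X = (\<lambda>x. g (h x)) ` X"
      using q by (simp add: image_image cong: image_cong)
    also have "\<dots> = g ` Y"
      using assms(2) assms(3) by (auto simp: image_iff) metis
    finally show "q ` f ` X = g ` Y" .
  qed
  then show ?thesis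
    using bij_betw_inv_into by blast
qed

text \<open>The facts on \<open>sorted_key_list_of_set\<close> live in a locale over a set on which
  the key is injective; here \<open>B\<close> itself is that set.\<close>

lemma (in linorder) length_sorted_key_list_of_set_inj_on:
  assumes "inj_on f B"
  shows "length (sorted_key_list_of_set f B) = card B"
proof -
  interpret folding_insort_key "(\<le>)" "(<)" B f
    by unfold_locales (rule assms)
  show ?thesis by simp
qed

lemma (in group_action) orbit_eq_iff:
  assumes "x \<in> E" "y \<in> E"
  shows "orbit G \<phi> x = orbit G \<phi> y \<longleftrightarrow> y \<in> orbit G \<phi> x"
proof
  show "y \<in> orbit G \<phi> x" if "orbit G \<phi> x = orbit G \<phi> y"
    using that orbit_refl assms by blast
  have sub: "orbit G \<phi> v \<subseteq> orbit G \<phi> u" if "u \<in> E" "v \<in> E" "v \<in> orbit G \<phi> u" for u v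
    using that orbit_trans[OF that(1,2)] element_image unfolding orbit_def by fast
  show "orbit G \<phi> x = orbit G \<phi> y" if "y \<in> orbit G \<phi> x"
    using that sub orbit_sym assms by blast
qed

text \<open>Carries facts on orbits from the restricted actions, which are instances of
  \<open>group_action\<close>, over to the plain shifts and rotations.\<close>

lemma orbit_restrict:
  "x \<in> E \<Longrightarrow> orbit G (\<lambda>g. restrict (\<phi> g) E) x = orbit G \<phi> x"
  by (simp add: orbit_def)

section \<open>Blocks and their first elements\<close>

text \<open>These points index the blocks, and are easier to count and to shift than maximal
  intervals.\<close>

definition starts :: "nat \<Rightarrow> int set \<Rightarrow> int set" where
  "starts n A = {a \<in> A. (a - 1) mod int n \<notin> A}"

text \<open>The predecessor of \<open>d + i\<close> with \<open>i > 0\<close> is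
  \<open>d + (i - 1)\<close>, again in the interval, so only the initial point can lack one.\<close>

lemma cyclic_interval_pred:
  assumes "x \<in> cyclic_interval n d m" "(x - 1) mod int n \<notin> cyclic_interval n d m"
  shows "x = d mod int n"
proof -
  obtain i where i: "i < m" "x = (d + int i) mod int n"
    using assms(1) by (auto simp: cyclic_interval_def)
  have "i = 0"
  proof (rule ccontr)
    assume "i \<noteq> 0"
    then have "(x - 1) mod int n = (d + int (i - 1)) mod int n"
      using i by (simp add: mod_simps of_nat_diff algebra_simps)
    moreover have "i - 1 < m" using i by simp
    ultimately show False using assms(2) by (auto simp: cyclic_interval_def)
  qed
  then show ?thesis using i by simp
qed

lemma mem_cyclic_interval: "i < m \<Longrightarrow> (d + int i) mod int n \<in> cyclic_interval n d m"
  by (auto simp: cyclic_interval_def)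

lemma cyclic_interval_mono: "m \<le> m' \<Longrightarrow> cyclic_interval n d m \<subseteq> cyclic_interval n d m'"
  by (auto simp: cyclic_interval_def)

context
  fixes n :: nat and A :: "int set"
  assumes n: "n > 0" and A: "A \<subset> {0..<int n}"
begin

definition run_length :: "int \<Rightarrow> nat" where
  "run_length a = (LEAST m. (a + int m) mod int n \<notin> A)"

lemma mod_mem: "a \<in> A \<Longrightarrow> a mod int n = a"
  using A by auto

text \<open>As \<open>A\<close> is proper, some \<open>e\<close> is missing from it, and walking
  forward from \<open>a\<close> reaches \<open>e\<close>. Hence the minimum in
  \<open>run_length\<close> is attained.\<close>

lemma ex_run_end: "\<exists>m. (a + int m) mod int n \<notin> A"
proof -
  obtain e where e: "e \<in> {0..<int n}" "e \<notin> A" using A by blast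
  have "(a + int (nat ((e - a) mod int n))) mod int n = e"
    using n e by (simp add: mod_simps)
  then show ?thesis using e by metis
qed

lemma run_end: "(a + int (run_length a)) mod int n \<notin> A"
  unfolding run_length_def using ex_run_end by (rule LeastI_ex)

text \<open>Reduces containment in \<open>A\<close> to comparing lengths: among intervals from
  \<open>a\<close> inside \<open>A\<close>, the one of length \<open>run_length a\<close> contains
  all others.\<close>

lemma interval_subset_iff: "cyclic_interval n a m \<subseteq> A \<longleftrightarrow> m \<le> run_length a"
proof
  assume "cyclic_interval n a m \<subseteq> A"
  then show "m \<le> run_length a"
    using run_end[of a] mem_cyclic_interval[of "run_length a" m a n] by force
next
  assume "m \<le> run_length a"
  then show "cyclic_interval n a m \<subseteq> A"
    using not_less_Least[of _ "\<lambda>m. (a + int m) mod int n \<notin> A"]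
    by (auto simp: cyclic_interval_def run_length_def)
qed

lemma run_length_pos: "a \<in> A \<Longrightarrow> run_length a > 0"
  using run_end[of a] mod_mem by (cases "run_length a") auto

definition run :: "int \<Rightarrow> int set" where
  "run a = cyclic_interval n a (run_length a)"

lemma run_in_blocks:
  assumes "a \<in> starts n A"
  shows "run a \<in> blocks n A"
proof -
  have a: "a \<in> A" "(a - 1) mod int n \<notin> A" using assms by (auto simp: starts_def)
  have sub: "run a \<subseteq> A" by (simp add: run_def interval_subset_iff)
  have mem: "a \<in> run a"
    using mem_cyclic_interval[OF run_length_pos[OF a(1)], of a n] mod_mem a by (simp add: run_def)
  have "consecutive n (run a)"
    unfolding consecutive_def run_def using a A n run_length_pos
    by (auto simp: carrier_integer_mod_group Suc_le_eq intro!: bexI[of _ a] exI[of _ "run_length a"])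
  moreover have "D' = run a" if D': "D' \<subseteq> A" "consecutive n D'" "run a \<subseteq> D'" for D'
  proof -
    obtain d m where d: "d \<in> {0..<int n}" "D' = cyclic_interval n d m"
      using D'(2) n by (auto simp: consecutive_def carrier_integer_mod_group)
    \<comment> \<open>The predecessor of \<open>a\<close> is outside \<open>A\<close>, hence outside
      \<open>D'\<close>, so \<open>D'\<close> can only begin at \<open>a\<close>; both intervals are
      then compared by length.\<close>
    have "a = d" using cyclic_interval_pred[of a n d m] mem a D' d by auto
    then show ?thesis
      using D' d interval_subset_iff cyclic_interval_mono by (metis run_def subset_antisym)
  qed
  ultimately show ?thesis using sub by (auto simp: blocks_def)
qed

text \<open>A block whose first point had its predecessor in \<open>A\<close> could be extended
  backwards. Maximality rules this out, unless the block already wraps around all of the cycle,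
  which a proper subset forbids.\<close>

lemma blocks_eq_run_starts: "blocks n A = run ` starts n A"
proof
  show "run ` starts n A \<subseteq> blocks n A" using run_in_blocks by blast
  show "blocks n A \<subseteq> run ` starts n A"
  proof
    fix D assume D: "D \<in> blocks n A"
    then obtain d m where d: "d \<in> {0..<int n}" "m \<ge> 1" "D = cyclic_interval n d m" and DA: "D \<subseteq> A"
      using n by (auto simp: blocks_def consecutive_def carrier_integer_mod_group)
    have max: "D' = D" if "D' \<subseteq> A" "consecutive n D'" "D \<subseteq> D'" for D'
      using D that by (auto simp: blocks_def)
    have "d \<in> D" using d mem_cyclic_interval[of 0 m d n] by auto
    have "(d - 1) mod int n \<notin> A"
    proof
      assume pred: "(d - 1) mod int n \<in> A"
      let ?e = "(d - 1) mod int n"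
      have "cyclic_interval n ?e (Suc m) = insert ?e D"
        unfolding d cyclic_interval_def
        by (auto simp: lessThan_Suc_eq_insert_0 image_image mod_simps algebra_simps)
      moreover have "consecutive n (cyclic_interval n ?e (Suc m))"
        unfolding consecutive_def using n
        by (intro bexI[of _ ?e] exI[of _ "Suc m"]) (auto simp: carrier_integer_mod_group)
      ultimately have "insert ?e D = D" using max[of "insert ?e D"] pred DA by auto
      \<comment> \<open>The extension adds nothing, so the interval has wrapped:
        \<open>d - 1 = d + i\<close> modulo \<open>n\<close> forces \<open>n\<close> to divide
        \<open>i + 1\<close>, and then \<open>A\<close> would contain every residue.\<close>
      then have "?e \<in> D" by auto
      then obtain i where i: "i < m" "?e = (d + int i) mod int n"
        unfolding d cyclic_interval_def by auto
      have "(d - 1 - (d + int i)) mod int n = 0"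
        using i(2) by (metis mod_0 mod_diff_eq diff_self mod_diff_cong)
      then have "int n dvd int (Suc i)"
        by (simp add: mod_eq_0_iff_dvd dvd_minus_iff[symmetric, of _ "1 + int i"] algebra_simps)
      then have "n \<le> Suc i" by (metis int_dvd_int_iff dvd_imp_le zero_less_Suc)
      then have "n \<le> m" using i by simp
      then have "n \<le> run_length d"
        using interval_subset_iff d DA by (metis order_trans)
      then have "cyclic_interval n d n \<subseteq> A" by (simp add: interval_subset_iff)
      moreover have "x \<in> cyclic_interval n d n" if "x \<in> {0..<int n}" for x
        using that n mem_cyclic_interval[of "nat ((x - d) mod int n)" n d n]
        by (simp add: mod_simps nat_less_iff)
      ultimately show False using A by blast
    qed
    then have s: "d \<in> starts n A" using \<open>d \<in> D\<close> DA by (auto simp: starts_def)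
    moreover have "run d = D"
    proof (rule max)
      show "run d \<subseteq> A" "consecutive n (run d)"
        using run_in_blocks[OF s] by (auto simp: blocks_def)
      show "D \<subseteq> run d"
        using DA d interval_subset_iff cyclic_interval_mono by (metis run_def)
    qed
    ultimately show "D \<in> run ` starts n A" by blast
  qed
qed

text \<open>Every other point of the run has its predecessor in the run, hence in \<open>A\<close>,
  so the definite description is legitimate. It also shows that distinct starts give distinct
  runs.\<close>

lemma block_first_run:
  assumes "a \<in> starts n A"
  shows "block_first n A (run a) = a"
  unfolding block_first_def
proof (rule the_equality)
  have a: "a \<in> A" "(a - 1) mod int n \<notin> A" using assms by (auto simp: starts_def)
  show "a \<in> run a \<and> (a - 1) mod int n \<notin> A"
    using mem_cyclic_interval[OF run_length_pos[OF a(1)], of a n] mod_mem a by (simp add: run_def)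
  fix d assume "d \<in> run a \<and> (d - 1) mod int n \<notin> A"
  moreover have "run a \<subseteq> A" by (simp add: run_def interval_subset_iff)
  ultimately have "d = a mod int n"
    unfolding run_def using cyclic_interval_pred by blast
  then show "d = a" using a mod_mem by simp
qed

lemma length_block_composition: "length (block_composition n A) = card (starts n A)"
proof -
  have inj: "inj_on (block_first n A) (blocks n A)"
    by (auto simp: blocks_eq_run_starts inj_on_def block_first_run)
  have "length (block_composition n A) = card (blocks n A)"
    by (simp add: block_composition_def block_structure_def length_sorted_key_list_of_set_inj_on[OF inj])
  also have "\<dots> = card (starts n A)"
    unfolding blocks_eq_run_starts
    by (rule card_image) (metis block_first_run inj_onI)
  finally show ?thesis .
qed

end

section \<open>Binary words and their runs\<close>

text \<open>A pair of compositions of equal length is zipped into one list, so that a simultaneous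
  shift becomes a single rotation.\<close>

definition run_word :: "(nat \<times> nat) list \<Rightarrow> bool list" where
  "run_word z = concat (map (\<lambda>(a, b). replicate a True @ replicate b False) z)"

definition positive :: "(nat \<times> nat) list \<Rightarrow> bool" where
  "positive z \<longleftrightarrow> (\<forall>(a, b)\<in>set z. 0 < a \<and> 0 < b)"

definition cut_at_start :: "bool list \<Rightarrow> bool" where
  "cut_at_start w \<longleftrightarrow> w = [] \<or> hd w \<and> \<not> last w"

lemma run_word_simps [simp]:
  "run_word [] = []"
  "run_word ((a, b) # z) = replicate a True @ replicate b False @ run_word z"
  "run_word (y @ z) = run_word y @ run_word z"
  by (simp_all add: run_word_def)

lemma positive_simps [simp]:
  "positive []"
  "positive ((a, b) # z) \<longleftrightarrow> 0 < a \<and> 0 < b \<and> positive z"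
  "positive (y @ z) \<longleftrightarrow> positive y \<and> positive z"
  by (auto simp: positive_def)

lemma cut_at_start_run_word: "positive z \<Longrightarrow> cut_at_start (run_word z)"
  by (induction z) (auto simp: cut_at_start_def hd_append last_append split: if_splits)

text \<open>Peel off the leading \<open>True\<close> letters \<open>u\<close> and then the
  \<open>False\<close> letters \<open>s\<close>; the rest \<open>t\<close> is shorter and satisfies
  the same condition.\<close>

lemma ex_run_word:
  assumes "cut_at_start w"
  shows "\<exists>z. positive z \<and> run_word z = w"
  using assms
proof (induction w rule: length_induct)
  case (1 w)
  show ?case
  proof (cases "w = []")
    case True
    then show ?thesis by (intro exI[of _ "[]"]) simp
  next
    case False
    then have hl: "hd w" "\<not> last w" using 1(2) by (auto simp: cut_at_start_def)
    define u where "u = takeWhile id w"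
    define v where "v = dropWhile id w"
    define s where "s = takeWhile Not v"
    define t where "t = dropWhile Not v"
    have w: "w = u @ v" and v: "v = s @ t" by (simp_all add: u_def v_def s_def t_def)
    have u: "replicate (length u) True = u" unfolding eq_commute[of _ u]
      by (rule replicate_eqI) (auto simp: u_def dest: set_takeWhileD)
    have s: "replicate (length s) False = s" unfolding eq_commute[of _ s]
      by (rule replicate_eqI) (auto simp: s_def dest: set_takeWhileD)
    have "u \<noteq> []" using hl False by (cases w) (auto simp: u_def)
    have "v \<noteq> []"
    proof
      assume "v = []"
      then have "last w \<in> set u" using w False by auto
      then show False using hl by (auto simp: u_def dest: set_takeWhileD)
    qed
    then have "\<not> hd v" using hd_dropWhile[of id w] by (simp add: v_def)
    then have "s \<noteq> []" using \<open>v \<noteq> []\<close> by (cases v) (auto simp: s_def)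
    have "t = [] \<or> hd t" using hd_dropWhile[of Not v] by (auto simp: t_def)
    moreover have "t = [] \<or> \<not> last t" using hl(2) unfolding w v by auto
    ultimately have "cut_at_start t" by (auto simp: cut_at_start_def)
    moreover have "length t < length w" using w v \<open>u \<noteq> []\<close> by simp
    ultimately obtain z where "positive z" "run_word z = t" using 1(1) by blast
    then show ?thesis
      using \<open>u \<noteq> []\<close> \<open>s \<noteq> []\<close> by (intro exI[of _ "(length u, length s) # z"]) (simp add: u s w[symmetric] v[symmetric])
  qed
qed

text \<open>The initial constant stretch is recovered by \<open>takeWhile\<close>, since what
  follows does not continue it.\<close>

lemma replicate_append_eqD:
  assumes "replicate a x @ u = replicate b x @ v" "u = [] \<or> hd u \<noteq> x" "v = [] \<or> hd v \<noteq> x"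
  shows "a = b \<and> u = v"
proof -
  have "takeWhile (\<lambda>y. y = x) (replicate c x @ w) = replicate c x" if "w = [] \<or> hd w \<noteq> x" for c w
    using that by (cases w) (auto simp: takeWhile_append)
  then have "replicate a x = replicate b x" using assms by metis
  then show ?thesis using assms(1) by auto
qed

lemma run_word_inj:
  assumes "positive y" "positive z" "run_word y = run_word z"
  shows "y = z"
  using assms
proof (induction y arbitrary: z)
  case Nil
  then show ?case by (cases z) auto
next
  case (Cons p y)
  obtain a b where p: "p = (a, b)" by fastforce
  obtain a' b' z' where z: "z = (a', b') # z'" using Cons.prems p by (cases z) auto
  have pos: "0 < a" "0 < b" "0 < a'" "0 < b'" "positive y" "positive z'"
    using Cons.prems p z by auto
  have "a = a' \<and> replicate b False @ run_word y = replicate b' False @ run_word z'"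
    by (rule replicate_append_eqD[of _ True]) (use Cons.prems p z pos in \<open>auto simp: hd_append\<close>)
  \<comment> \<open>The remaining words are empty or begin with \<open>True\<close>, so the stretch
    of \<open>False\<close> letters ends where they start.\<close>
  moreover have "b = b' \<and> run_word y = run_word z'"
    by (rule replicate_append_eqD[of _ False])
      (use calculation cut_at_start_run_word pos in \<open>auto simp: cut_at_start_def\<close>)
  ultimately show ?case using Cons.IH pos p z by auto
qed

text \<open>Moving whole pieces to the end of the list rotates the word by their total
  length.\<close>

lemma run_word_rotate: "\<exists>m. run_word (rotate t z) = rotate m (run_word z)"
proof -
  let ?i = "t mod length z"
  have "run_word (rotate t z) = run_word (drop ?i z) @ run_word (take ?i z)"
    by (simp add: rotate_drop_take)
  also have "\<dots> = rotate (length (run_word (take ?i z))) (run_word (take ?i z @ drop ?i z))"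
    by (simp only: rotate_append run_word_simps)
  finally show ?thesis by auto
qed

lemma rotate_of_run_word_rotate:
  assumes "positive y" "positive z" "run_word y = rotate m (run_word z)"
  shows "\<exists>t. y = rotate t z"
proof -
  let ?w = "run_word z"
  define i where "i = m mod length ?w"
  define u v where "u = take i ?w" and "v = drop i ?w"
  have y: "run_word y = v @ u" and z: "run_word z = u @ v"
    using assms(3) by (simp_all add: rotate_drop_take u_def v_def i_def)
  \<comment> \<open>If both are nonempty, \<open>u\<close> begins like \<open>run_word z\<close> and
    ends like \<open>run_word y\<close>, while \<open>v\<close> begins like
    \<open>run_word y\<close> and ends like \<open>run_word z\<close>.\<close>
  have "cut_at_start u" "cut_at_start v"
    using cut_at_start_run_word[OF assms(1)] cut_at_start_run_word[OF assms(2)] y z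
    by (auto simp: cut_at_start_def hd_append last_append split: if_splits)
  then obtain p q where p: "positive p" "run_word p = u" and q: "positive q" "run_word q = v"
    using ex_run_word by metis
  have "z = p @ q" "y = q @ p"
    using p q y z assms by (auto intro!: run_word_inj)
  then show ?thesis using rotate_append by metis
qed

section \<open>Words as subsets\<close>

definition support :: "bool list \<Rightarrow> int set" where
  "support w = int ` {i. i < length w \<and> w ! i}"

lemma mem_support: "x \<in> support w \<longleftrightarrow> 0 \<le> x \<and> x < int (length w) \<and> w ! nat x"
  by (auto simp: support_def image_iff intro!: exI[of _ "nat x"])

lemma support_inj:
  assumes "length u = length w" "support u = support w"
  shows "u = w"
proof (rule nth_equalityI)
  fix i assume i: "i < length u"
  have "int i \<in> support u \<longleftrightarrow> int i \<in> support w" using assms(2) by simp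
  then show "u ! i = w ! i" using i assms(1) by (simp add: mem_support)
qed (fact assms(1))

lemma ex_support: "A \<subseteq> {0..<int n} \<Longrightarrow> \<exists>w. length w = n \<and> support w = A"
  by (rule exI[of _ "map (\<lambda>i. int i \<in> A) [0..<n]"]) (auto simp: mem_support subset_iff nat_less_iff)

lemma support_subset: "support w \<subseteq> {0..<int (length w)}"
  by (auto simp: mem_support)

lemma card_support: "card (support w) = length (filter id w)"
  by (simp add: support_def card_image length_filter_conv_card)

text \<open>Rewriting by the inverse shift turns identities between shifted sets into congruences
  for single points.\<close>

lemma mem_shift_set:
  assumes "A \<subseteq> {0..<int n}" "n > 0"
  shows "x \<in> shift_set n s A \<longleftrightarrow> 0 \<le> x \<and> x < int n \<and> (x - s) mod int n \<in> A"
proof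
  assume "x \<in> shift_set n s A"
  then obtain a where a: "a \<in> A" "x = (a + s) mod int n" by (auto simp: shift_set_def)
  then have "(x - s) mod int n = a" using assms by (auto simp: mod_simps)
  then show "0 \<le> x \<and> x < int n \<and> (x - s) mod int n \<in> A" using a assms by auto
next
  assume x: "0 \<le> x \<and> x < int n \<and> (x - s) mod int n \<in> A"
  then have "x = ((x - s) mod int n + s) mod int n" by (simp add: mod_simps)
  then show "x \<in> shift_set n s A" using x by (auto simp: shift_set_def)
qed

text \<open>\<open>rotate\<close> moves to the left: the letter at index \<open>m\<close> goes to
  index 0, so the support is shifted by \<open>-m\<close>.\<close>

lemma support_rotate:
  assumes "length w = n" "n > 0"
  shows "support (rotate m w) = shift_set n ((- int m) mod int n) (support w)"
proof -
  have "x \<in> support (rotate m w) \<longleftrightarrow> x \<in> shift_set n ((- int m) mod int n) (support w)" for x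
  proof (cases "0 \<le> x \<and> x < int n")
    case True
    then have "(x - (- int m) mod int n) mod int n = int ((m + nat x) mod n)"
      by (simp add: mod_simps zmod_int algebra_simps)
    then show ?thesis
      using True assms support_subset[of w]
      by (simp add: mem_shift_set mem_support nth_rotate nat_less_iff)
  qed (use assms support_subset[of w] in \<open>auto simp: mem_shift_set mem_support\<close>)
  then show ?thesis by blast
qed

text \<open>Conversely, each shift of a support comes from a rotation; for \<open>s = 0\<close> it
  is the full rotation by \<open>n\<close>.\<close>

lemma shift_set_support:
  assumes "length w = n" "n > 0" "s \<in> {0..<int n}"
  shows "shift_set n s (support w) = support (rotate (nat (int n - s)) w)"
  using assms by (simp add: support_rotate)

lemma starts_shift_set:
  assumes "A \<subseteq> {0..<int n}" "n > 0"
  shows "starts n (shift_set n s A) = shift_set n s (starts n A)"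
proof -
  have "starts n A \<subseteq> {0..<int n}" using assms by (auto simp: starts_def)
  moreover have "((x - 1) mod int n - s) mod int n = ((x - s) mod int n - 1) mod int n" for x
    by (simp add: mod_simps algebra_simps)
  ultimately show ?thesis
    using assms by (auto simp: starts_def mem_shift_set)
qed

lemma card_shift_set:
  assumes "A \<subseteq> {0..<int n}" "n > 0"
  shows "card (shift_set n s A) = card A"
proof -
  have "inj_on (\<lambda>a. (a + s) mod int n) A"
  proof (rule inj_on_inverseI)
    show "((a + s) mod int n - s) mod int n = a" if "a \<in> A" for a
      using assms that by (auto simp: mod_simps)
  qed
  then show ?thesis by (simp add: shift_set_def card_image)
qed

text \<open>The cyclic predecessor of index 0 is the last index, which carries \<open>False\<close>.
  The cyclic condition thus becomes a linear one, with index 0 treated separately.\<close>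

lemma starts_support_run_word:
  assumes "positive z" "w = run_word z"
  shows "starts (length w) (support w) = int ` {i. i < length w \<and> w ! i \<and> (i = 0 \<or> \<not> w ! (i - 1))}"
proof -
  have "int i \<in> starts (length w) (support w) \<longleftrightarrow> w ! i \<and> (i = 0 \<or> \<not> w ! (i - 1))"
    if "i < length w" for i
  proof (cases "i = 0")
    case True
    have "\<not> w ! (length w - 1)"
      using cut_at_start_run_word[OF assms(1), folded assms(2)] that last_conv_nth[of w]
      by (cases "w = []") (auto simp: cut_at_start_def)
    moreover have "nat ((- 1) mod int (length w)) = length w - 1"
      using that by (cases w) (auto simp: zmod_minus1)
    ultimately show ?thesis using True that by (simp add: starts_def mem_support)
  next
    case False
    then have "nat ((int i - 1) mod int (length w)) = i - 1"
      using that by simp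
    then show ?thesis using False that by (auto simp: starts_def mem_support)
  qed
  moreover have "starts (length w) (support w) \<subseteq> int ` {..<length w}"
    by (auto simp: starts_def support_def)
  ultimately show ?thesis by blast
qed

text \<open>Induction from the right keeps earlier positions fixed. The appended piece adds exactly
  the start \<open>length u\<close>, because \<open>u\<close> is empty or ends with
  \<open>False\<close>.\<close>

lemma card_linear_starts:
  assumes "positive z" "w = run_word z"
  shows "card {i. i < length w \<and> w ! i \<and> (i = 0 \<or> \<not> w ! (i - 1))} = length z"
  using assms
proof (induction z arbitrary: w rule: rev_induct)
  case Nil
  then show ?case by simp
next
  case (snoc p z)
  obtain a b where p: "p = (a, b)" by fastforce
  define u where "u = run_word z"
  let ?S = "\<lambda>w. {i. i < length w \<and> w ! i \<and> (i = 0 \<or> \<not> w ! (i - 1))}"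
  have pos: "0 < a" "0 < b" "positive z" using snoc.prems p by auto
  have w: "w = u @ replicate a True @ replicate b False" using snoc.prems p u_def by simp
  have u: "\<not> u ! (length u - 1)" if "u \<noteq> []"
    using cut_at_start_run_word[OF pos(3)] that by (simp add: u_def cut_at_start_def last_conv_nth)
  have "i \<in> ?S w \<longleftrightarrow> i \<in> insert (length u) (?S u)" for i
  proof -
    consider "i < length u" | "i = length u" | "i > length u" by linarith
    then show ?thesis
    proof cases
      case 1
      then show ?thesis by (auto simp: w nth_append)
    next
      case 2
      then show ?thesis using u pos by (cases "u = []") (auto simp: w nth_append)
    next
      case 3
      then show ?thesis by (auto simp: w nth_append split: if_splits)
    qed
  qed
  then have "?S w = insert (length u) (?S u)" by blast
  then show ?case using snoc.IH[OF pos(3) u_def] by simp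
qed

lemma card_starts_support_run_word:
  "positive z \<Longrightarrow> card (starts (length (run_word z)) (support (run_word z))) = length z"
  by (simp add: starts_support_run_word[OF _ refl] card_image card_linear_starts[OF _ refl, simplified])

lemma length_run_word: "length (run_word z) = sum_list (map fst z) + sum_list (map snd z)"
  by (induction z) auto

lemma length_filter_run_word: "length (filter id (run_word z)) = sum_list (map fst z)"
  by (induction z) auto

section \<open>The correspondence\<close>

text \<open>A set of size \<open>k < n\<close> is a proper subset, so its blocks are counted by its
  starts.\<close>

lemma subsets_with_blocks_eq:
  assumes "1 \<le> k" "k < n"
  shows "subsets_with_blocks n k r = {A. A \<subseteq> {0..<int n} \<and> card A = k \<and> card (starts n A) = r}"
proof -
  have "A \<subset> {0..<int n}" if "A \<subseteq> {0..<int n}" "card A = k" for A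
    using that assms by auto
  then show ?thesis
    using assms length_block_composition[of n]
    by (auto simp: subsets_with_blocks_def carrier_integer_mod_group)
qed

lemma rotate_zip:
  assumes "length xs = length ys"
  shows "zip (rotate t xs) (rotate t ys) = rotate t (zip xs ys)"
proof (rule nth_equalityI)
  fix i assume "i < length (zip (rotate t xs) (rotate t ys))"
  then have "i < length ys" using assms by simp
  moreover from this have "(t + i) mod length ys < length ys" by (intro mod_less_divisor) linarith
  ultimately show "zip (rotate t xs) (rotate t ys) ! i = rotate t (zip xs ys) ! i"
    using assms by (simp add: nth_rotate)
qed (use assms in simp)

lemma positive_zip:
  assumes "c \<in> compositions k r" "d \<in> compositions l r"
  shows "positive (zip c d)"
  using assms by (fastforce simp: positive_def compositions_def dest: set_zip_leftD set_zip_rightD)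

lemma compositions_unzip:
  assumes "positive z"
  shows "map fst z \<in> compositions (sum_list (map fst z)) (length z)"
    and "map snd z \<in> compositions (sum_list (map snd z)) (length z)"
  using assms by (fastforce simp: positive_def compositions_def)+

theorem theorem7p4:
  fixes n k r :: nat
  assumes "n \<ge> 2" and "1 \<le> k" and "k \<le> n - 1" and "r \<ge> 1"
  shows "\<exists>f. bij_betw f
           (orbits (integer_mod_group n) (subsets_with_blocks n k r) (shift_set n))
           (orbits (integer_mod_group r) (compositions k r \<times> compositions (n - k) r) rotate_pair)"
proof -
  let ?Z = "compositions k r \<times> compositions (n - k) r"
  let ?S = "subsets_with_blocks n k r"
  let ?G = "integer_mod_group n" and ?H = "integer_mod_group r"
  let ?oS = "orbit ?G (shift_set n)" and ?oZ = "orbit ?H rotate_pair"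
  \<comment> \<open>\<open>F\<close> lays out blocks and gaps alternately from position 0; the orbit
    of the result forgets this choice of cut.\<close>
  define F where "F p = support (run_word (zip (fst p) (snd p)))" for p :: "nat list \<times> nat list"
  have n: "n > 0" and k: "k < n" using assms by auto
  have carrier: "carrier ?G = {0..<int n}" "carrier ?H = {0..<int r}"
    using assms by (auto simp: carrier_integer_mod_group)
  have S: "?S = {A. A \<subseteq> {0..<int n} \<and> card A = k \<and> card (starts n A) = r}"
    using subsets_with_blocks_eq assms k by simp
  interpret aS: group_action ?G "Pow (carrier ?G)"
    "\<lambda>s. restrict (shift_set n s) (Pow (carrier ?G))"
    by (rule group_action_shift_set[OF n])
  interpret aZ: group_action ?H ?Z "\<lambda>s. restrict (rotate_pair s) ?Z"
    by (rule group_action_rotate_pair) (use assms in simp)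
  have oS: "?oS A = ?oS B \<longleftrightarrow> (\<exists>s\<in>{0..<int n}. B = shift_set n s A)"
    if "A \<subseteq> {0..<int n}" "B \<subseteq> {0..<int n}" for A B
    using aS.orbit_eq_iff[of A B] that by (simp add: carrier orbit_restrict) (auto simp: orbit_def carrier)
  have oZ: "?oZ p = ?oZ q \<longleftrightarrow> (\<exists>t\<in>{0..<int r}. q = rotate_pair t p)"
    if "p \<in> ?Z" "q \<in> ?Z" for p q
    using aZ.orbit_eq_iff[of p q] that by (simp add: orbit_restrict) (auto simp: orbit_def carrier)
  have Z: "positive (zip (fst p) (snd p))" "map fst (zip (fst p) (snd p)) = fst p"
    "map snd (zip (fst p) (snd p)) = snd p" "length (zip (fst p) (snd p)) = r"
    "length (run_word (zip (fst p) (snd p))) = n" if "p \<in> ?Z" for p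
    using that k by (auto simp: positive_zip length_run_word) (auto simp: compositions_def)
  have FS: "F p \<in> ?S" if "p \<in> ?Z" for p
  proof -
    have "sum_list (fst p) = k" using that by (auto simp: compositions_def)
    then show ?thesis
      using Z[OF that] support_subset[of "run_word (zip (fst p) (snd p))"]
        card_starts_support_run_word[OF Z(1)[OF that]]
      by (simp add: S F_def card_support length_filter_run_word)
  qed
  have iff: "?oZ p = ?oZ q \<longleftrightarrow> ?oS (F p) = ?oS (F q)" if p: "p \<in> ?Z" and q: "q \<in> ?Z" for p q
  proof -
    let ?p = "zip (fst p) (snd p)" and ?q = "zip (fst q) (snd q)"
    have len: "length (fst p) = length (snd p)" "length (fst p) = r"
      using p by (auto simp: compositions_def)
    have F: "F p \<subseteq> {0..<int n}" "F q \<subseteq> {0..<int n}" using FS p q S by auto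
    have rot: "zip (fst (rotate_pair t p)) (snd (rotate_pair t p)) = rotate (nat t) ?p" for t
      using len by (simp add: rotate_pair_def rotate_zip)
    show ?thesis
    proof
      assume "?oZ p = ?oZ q"
      then obtain t where "q = rotate_pair t p" using oZ p q by blast
      then have "?q = rotate (nat t) ?p" using rot by simp
      then obtain m where "run_word ?q = rotate m (run_word ?p)" using run_word_rotate by metis
      then have "F q = shift_set n ((- int m) mod int n) (F p)"
        using support_rotate[OF Z(5)[OF p] n] by (simp add: F_def)
      then show "?oS (F p) = ?oS (F q)"
        using oS[OF F] n by force
    next
      assume "?oS (F p) = ?oS (F q)"
      then obtain s where "s \<in> {0..<int n}" "F q = shift_set n s (F p)" using oS[OF F] by blast
      then obtain m where "support (run_word ?q) = support (rotate m (run_word ?p))"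
        using shift_set_support[OF Z(5)[OF p] n] unfolding F_def by metis
      then have "run_word ?q = rotate m (run_word ?p)"
        using support_inj Z(5)[OF p] Z(5)[OF q] length_rotate by metis
      then obtain t where "?q = rotate t ?p"
        using rotate_of_run_word_rotate Z(1) p q by metis
      \<comment> \<open>The rotation is reduced modulo the list length so that it comes from an
        element of the acting group.\<close>
      then have "?q = rotate (t mod r) ?p" using Z(4)[OF p] by (metis rotate_conv_mod)
      then have "?q = zip (fst (rotate_pair (int (t mod r)) p)) (snd (rotate_pair (int (t mod r)) p))"
        by (simp only: rot nat_int)
      then have "q = rotate_pair (int (t mod r)) p"
        using Z(2,3)[OF q] len
        by (metis (no_types, lifting) fst_map_prod length_rotate map_fst_zip map_snd_zip prod_eq_iff
            rotate_pair_def snd_map_prod)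
      moreover have "int (t mod r) \<in> {0..<int r}" using assms by simp
      ultimately show "?oZ p = ?oZ q" using oZ[OF p q] by blast
    qed
  qed
  have surj: "\<exists>p\<in>?Z. ?oS (F p) = ?oS A" if "A \<in> ?S" for A
  proof -
    have A: "A \<subseteq> {0..<int n}" "card A = k" "card (starts n A) = r" using that S by auto
    obtain w where w: "length w = n" "support w = A" using ex_support[OF A(1)] by blast
    \<comment> \<open>Here \<open>r >= 1\<close> enters: a start \<open>a\<close> exists, and the
      word of \<open>A\<close> is rotated so that it begins there.\<close>
    have "starts n A \<noteq> {}" using A(3) assms(4) by auto
    then obtain a where a: "a \<in> A" "(a - 1) mod int n \<notin> A" by (auto simp: starts_def)
    define m where "m = nat a"
    define v where "v = rotate m w"
    have m: "m < n" "int m = a" using a A(1) by (auto simp: m_def nat_less_iff subset_iff)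
    have "v ! 0" using a m w n by (auto simp: v_def nth_rotate mem_support)
    \<comment> \<open>The last letter of \<open>v\<close> is the letter of \<open>w\<close>
      cyclically before index \<open>m\<close>, and \<open>a\<close> is a start.\<close>
    moreover have "\<not> v ! (n - 1)"
    proof -
      have "(a - 1) mod int n = int ((m + (n - 1)) mod n)"
        using m n by (simp add: zmod_int of_nat_diff mod_simps)
          (metis add.commute add_diff_eq mod_add_self2)
      then show ?thesis
        using a(2) w n by (auto simp: v_def nth_rotate mem_support)
    qed
    ultimately have "cut_at_start v"
      using w n by (auto simp: cut_at_start_def v_def hd_conv_nth last_conv_nth)
    then obtain z where z: "positive z" "run_word z = v" using ex_run_word by blast
    define s where "s = (- int m) mod int n"
    have s: "s \<in> {0..<int n}" using n by (simp add: s_def)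
    have vA: "support v = shift_set n s A" using support_rotate w n by (simp add: v_def s_def)
    have lv: "length v = n" using w by (simp add: v_def)
    have "starts n A \<subseteq> {0..<int n}" using A by (auto simp: starts_def)
    \<comment> \<open>Shifting preserves the number of starts and the size, so the factorization
      \<open>z\<close> inherits both from \<open>A\<close>.\<close>
    then have "length z = r"
      using card_starts_support_run_word[OF z(1)] z(2) lv vA A n
      by (simp add: starts_shift_set card_shift_set)
    moreover have "sum_list (map fst z) = k"
      using card_support[of v] vA A n z(2) by (auto simp: card_shift_set length_filter_run_word)
    moreover have "sum_list (map snd z) = n - k"
      using length_run_word[of z] lv z(2) calculation(2) by simp
    ultimately have "(map fst z, map snd z) \<in> ?Z"
      using compositions_unzip[OF z(1)] by auto
    moreover have "F (map fst z, map snd z) = shift_set n s A"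
      using z vA by (simp add: F_def zip_map_fst_snd)
    moreover have "?oS A = ?oS (shift_set n s A)"
      using oS[OF A(1)] s vA support_subset[of v] lv by auto
    ultimately show ?thesis by (metis (no_types))
  qed
  have "orbits ?G ?S (shift_set n) = ?oS ` ?S" "orbits ?H ?Z rotate_pair = ?oZ ` ?Z"
    by (auto simp: orbits_def)
  then show ?thesis
    using ex_bij_betw_images[of ?Z ?oZ ?oS F ?S] iff FS surj by simp
qed

end
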